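(* Let $n\in\mathbb{Z}$ and let $k\ge 1$ be an integer. Then for every integer $N\ge 1$, $$T^k(N)+A_n=F_n^k(N+A_n).$$ Equivalently, for every $P\in D(n)$, $$T^k(P-A_n)=F_n^k(P)-A_n.$$
   Context: The Collatz function $T$ is defined on positive integers by $T(N)=\frac{N}{2}$ if $N$ is even and $T(N)=\frac{3}{2}N+\frac12$ if $N$ is odd. For $n\in\mathbb{Z}$, put $A_n=2n+1$ and $D(n)=\{P\in\mathbb{Z} : P\ge 2n+2\}$. The function $F_n$ is defined on $D(n)$, with integer values, by $F_n(P)=\frac{3}{2}P-n$ if $P$ is even, and $F_n(P)=\frac{P}{2}+\frac{2n+1}{2}$ if $P$ is odd (the formula makes sense for every integer $P$, and iterates are computed by applying it repeatedly). $T^k$ and $F_n^k$ denote $k$-fold iterates. *)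

theory Defs
  imports Complex_Main
begin

text \<open>Both maps take integer values on integers, so they are defined with the exact
  integer division; the lemmas \<open>of_int_collatz\<close> and \<open>of_int_conjF\<close> restate the defining
  formulas over the reals. The map \<open>collatz\<close> is only meant to be applied to positive
  integers and \<open>conjF n\<close> to elements of \<open>D n\<close>; these domains are preserved.\<close>

definition collatz :: "int \<Rightarrow> int" where
  "collatz N = (if even N then N div 2 else (3 * N + 1) div 2)"

definition A :: "int \<Rightarrow> int" where
  "A n = 2 * n + 1"

definition D :: "int \<Rightarrow> int set" where
  "D n = {P. P \<ge> 2 * n + 2}"

definition conjF :: "int \<Rightarrow> int \<Rightarrow> int" where
  "conjF n P = (if even P then (3 * P) div 2 - n else (P + (2 * n + 1)) div 2)"

lemma of_int_collatz:
  "real_of_int (collatz N) =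
     (if even N then real_of_int N / 2 else 3 / 2 * real_of_int N + 1 / 2)"
proof (cases "even N")
  case True
  then show ?thesis by (auto simp: collatz_def elim!: evenE)
next
  case False
  then obtain m where N: "N = 2 * m + 1" by (auto elim: oddE)
  have "(3 * N + 1) div 2 = 3 * m + 2" unfolding N by simp
  with False show ?thesis by (simp add: collatz_def N field_simps)
qed

lemma of_int_conjF:
  "real_of_int (conjF n P) =
     (if even P then 3 / 2 * real_of_int P - real_of_int n
      else real_of_int P / 2 + (2 * real_of_int n + 1) / 2)"
proof (cases "even P")
  case True
  then show ?thesis by (auto simp: conjF_def elim!: evenE)
next
  case False
  then obtain m where P: "P = 2 * m + 1" by (auto elim: oddE)
  have "(P + (2 * n + 1)) div 2 = m + n + 1" unfolding P by simp
  with False show ?thesis by (simp add: conjF_def P field_simps)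
qed

lemma collatz_pos: "N \<ge> 1 \<Longrightarrow> collatz N \<ge> 1"
  unfolding collatz_def by presburger

lemma conjF_in_D: "P \<in> D n \<Longrightarrow> conjF n P \<in> D n"
  unfolding conjF_def D_def mem_Collect_eq by presburger

end

theory Submission
  imports Defs
begin

text \<open>Translation by \<open>A n\<close> conjugates \<open>collatz\<close> to
  \<open>conjF n\<close>. As \<open>A n\<close> is odd, it swaps parities, so each branch of one map
  meets the opposite branch of the other: N/2 + A = ((N + A) + A)/2 for N even, and (3N + 1)/2 + A =
  3(N + A)/2 - n for N odd, since A = 2n + 1.\<close>

lemma collatz_add_A: "collatz N + A n = conjF n (N + A n)"
  unfolding collatz_def conjF_def A_def by presburger

text \<open>A conjugacy passes to iterates: the one-step identity carries the translation past one
  map at a time.\<close>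

lemma funpow_collatz_add_A: "(collatz ^^ k) N + A n = (conjF n ^^ k) (N + A n)"
  by (induction k) (simp_all add: collatz_add_A)

theorem theorem2p1:
  fixes n :: int and k :: nat
  assumes "k \<ge> 1"
  shows "(\<forall>N::int. N \<ge> 1 \<longrightarrow> (collatz ^^ k) N + A n = (conjF n ^^ k) (N + A n)) \<and>
         (\<forall>P\<in>D n. (collatz ^^ k) (P - A n) = (conjF n ^^ k) P - A n)"
proof (intro conjI allI impI ballI)
  fix N :: int
  show "(collatz ^^ k) N + A n = (conjF n ^^ k) (N + A n)"
    by (rule funpow_collatz_add_A)
next
  fix P
  show "(collatz ^^ k) (P - A n) = (conjF n ^^ k) P - A n"
    using funpow_collatz_add_A[of k "P - A n" n] by simp
qed

end
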